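(* Let $r\in(1,2]$, $L>0$, $\gamma:=r-1$, $c_0\in(0,1/8)$ and $p_*>0$. Let $K_n=\left(\frac{n}{\log n}\right)^{\frac1{2r+1}}$ and $M_n:=\lfloor K_n^\gamma\rfloor$. Let $f_{j,n}:[0,1]\to\mathbb R$, $j=0,1,\dots,M_n$, be the functions constructed in the context. Let $P_j$ denote the distribution of $(Y_{j,1},\dots,Y_{j,n})$, where $Y_{j,i}=f_{j,n}(X_i)+\xi_i$, $X_i=i/n$, $i=1,\dots,n$, and the $\xi_i$ are i.i.d. real random variables such that $K(P_j,P_0)\le p_*\sum_{i=1}^n\big(f_{j,n}(X_i)-f_{0,n}(X_i)\big)^2$, with $p_*$ independent of $n$ and of the $f_{j,n}$. Then for all $n$ sufficiently large: (1) each $f_{j,n}\in\mathcal C_H(r,L)$, $j=0,1,\dots,M_n$; (2) for all $j,k\in\{0,1,\dots,M_n\}$ with $j\neq k$, $\|f_{j,n}-f_{k,n}\|_\infty=2s_n$, where $s_n\asymp\left(\frac{\log n}{n}\right)^{\frac{r}{2r+1}}$; (3) $\displaystyle \frac1{M_n}\sum_{j=1}^{M_n}K(P_j,P_0)\le c_0\log(M_n)$.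
   Context: $\mathcal C_H(r,L)$ is the set of differentiable convex functions $f:[0,1]\to\mathbb R$ with $|f'(x_1)-f'(x_2)|\le L|x_1-x_2|^{\gamma}$ for all $x_1,x_2\in[0,1]$. $\|g\|_\infty=\sup_{x\in[0,1]}|g(x)|$. $a_n\asymp b_n$ means that $a_n/b_n$ is bounded below and above by positive constants for all large $n$. $K(P,Q)$ is the Kullback divergence: $K(P,Q)=\int\log\frac{dP}{dQ}\,dP$ if $P\ll Q$, and $+\infty$ otherwise. Construction (for $n$ large enough). Case 1, $\gamma\in(0,1)$. Let $\bar L:=\min\big(\tfrac L4,\sqrt{\tfrac{c_0\gamma}{12p_*}}\big)$. For $i=0,1,2,\dots$ set $$\bar g_{0,n}(x)=\begin{cases}2i\bar LK_n^{-\gamma}+\bar LK_n^{1-\gamma}\big(x-\tfrac{i}{K_n^\gamma}\big), & x\in[\tfrac i{K_n^\gamma},\tfrac i{K_n^\gamma}+\tfrac1{K_n})\\ (2i+1)\bar LK_n^{-\gamma}, & x\in[\tfrac i{K_n^\gamma}+\tfrac1{K_n},\tfrac i{K_n^\gamma}+\tfrac3{K_n})\\ (2i+1)\bar LK_n^{-\gamma}+\bar LK_n^{1-\gamma}\big[x-(\tfrac i{K_n^\gamma}+\tfrac3{K_n})\big], & x\in[\tfrac i{K_n^\gamma}+\tfrac3{K_n},\tfrac i{K_n^\gamma}+\tfrac4{K_n})\\ 2(i+1)\bar LK_n^{-\gamma}, & x\in[\tfrac i{K_n^\gamma}+\tfrac4{K_n},\tfrac{i+1}{K_n^\gamma}).\end{cases}$$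 For $j=1,\dots,\lfloor K_n^\gamma\rfloor$, $\bar g_{j,n}=\bar g_{0,n}$ except on $[\tfrac{j-1}{K_n^\gamma},\tfrac j{K_n^\gamma})$, where $$\bar g_{j,n}(x)=\begin{cases}2(j-1)\bar LK_n^{-\gamma}, & x\in[\tfrac{j-1}{K_n^\gamma},\tfrac{j-1}{K_n^\gamma}+\tfrac1{K_n})\\ 2(j-1)\bar LK_n^{-\gamma}+\bar LK_n^{1-\gamma}\big[x-(\tfrac{j-1}{K_n^\gamma}+\tfrac1{K_n})\big], & x\in[\tfrac{j-1}{K_n^\gamma}+\tfrac1{K_n},\tfrac{j-1}{K_n^\gamma}+\tfrac3{K_n})\\ 2j\bar LK_n^{-\gamma}, & x\in[\tfrac{j-1}{K_n^\gamma}+\tfrac3{K_n},\tfrac j{K_n^\gamma}).\end{cases}$$ Case 2, $\gamma=1$. Let $\bar L:=\min\big(L,\sqrt{\tfrac{c_0}{12p_*}}\big)$. For $i=0,1,2,\dots$ set $$\bar g_{0,n}(x)=\begin{cases}\bar L\tfrac{2i}{K_n}+\bar L\big(x-\tfrac{4i}{K_n}\big), & x\in[\tfrac{4i}{K_n},\tfrac{4i+1}{K_n})\\ \bar L\tfrac{2i+1}{K_n}, & x\in[\tfrac{4i+1}{K_n},\tfrac{4i+3}{K_n})\\ \bar L\tfrac{2i+1}{K_n}+\bar L\big(x-\tfrac{4i+3}{K_n}\big), & x\in[\tfrac{4i+3}{K_n},\tfrac{4(i+1)}{K_n}).\end{cases}$$ For $j=1,\dots,\lfloor K_n\rfloor$,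 $\bar g_{j,n}=\bar g_{0,n}$ except on $[\tfrac{4(j-1)}{K_n},\tfrac{4j}{K_n})$, where $$\bar g_{j,n}(x)=\begin{cases}\bar L\tfrac{2(j-1)}{K_n}, & x\in[\tfrac{4(j-1)}{K_n},\tfrac{4j-3}{K_n})\\ \bar L\tfrac{2(j-1)}{K_n}+\bar L\big(x-\tfrac{4j-3}{K_n}\big), & x\in[\tfrac{4j-3}{K_n},\tfrac{4j-1}{K_n})\\ \bar L\tfrac{2j}{K_n}, & x\in[\tfrac{4j-1}{K_n},\tfrac{4j}{K_n}).\end{cases}$$ In both cases let $g_{j,n}$ be the restriction of $\bar g_{j,n}$ to $[0,1]$ and $f_{j,n}(x):=\int_0^xg_{j,n}(t)\,dt$ for $x\in[0,1]$, $j=0,1,\dots,\lfloor K_n^\gamma\rfloor$.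
   Formalization: For r=2, item (2) is stated only for j,k ≤ ⌊K_n/4⌋, since for larger j (up to ⌊K_n⌋) with 4(j-1)/K_n ≥ 1 the function f_{j,n} equals f_{0,n} on [0,1] and the claim fails; item (3) is given for both ranges. *)

theory Defs
  imports "HOL-Probability.Probability"
begin

definition holder_convex :: "real \<Rightarrow> real \<Rightarrow> (real \<Rightarrow> real) set" where
  "holder_convex r L = {f. convex_on {0..1} f \<and>
     (\<exists>f'. (\<forall>x\<in>{0..1}. (f has_real_derivative f' x) (at x within {0..1})) \<and>
       (\<forall>x1\<in>{0..1}. \<forall>x2\<in>{0..1}. \<bar>f' x1 - f' x2\<bar> \<le> L * \<bar>x1 - x2\<bar> powr (r - 1)))}"

definition sup_norm :: "(real \<Rightarrow> real) \<Rightarrow> real" where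
  "sup_norm g = (SUP x\<in>{0..1}. \<bar>g x\<bar>)"

definition same_order :: "(nat \<Rightarrow> real) \<Rightarrow> (nat \<Rightarrow> real) \<Rightarrow> bool" where
  "same_order a b \<longleftrightarrow>
     (\<exists>c>0. \<exists>C>0. \<forall>\<^sub>F n in sequentially. c \<le> a n / b n \<and> a n / b n \<le> C)"

(* Argument order: K(P,Q) is the library's KL_divergence _ Q P, and
   absolutely_continuous Q P says P << Q.  For probability measures P << Q the negative part
   of log (dP/dQ) is always P-integrable, so if log (dP/dQ) is not P-integrable then its
   P-integral is +infinity. *)
definition kullback :: "'a measure \<Rightarrow> 'a measure \<Rightarrow> ereal" where
  "kullback P Q =
     (if absolutely_continuous Q P \<and> integrable P (entropy_density (exp 1) Q P)
      then ereal (KL_divergence (exp 1) Q P) else \<infinity>)"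

definition Kn :: "real \<Rightarrow> nat \<Rightarrow> real" where
  "Kn r n = (real n / ln (real n)) powr (1 / (2 * r + 1))"

definition Mn :: "real \<Rightarrow> nat \<Rightarrow> nat" where
  "Mn r n = nat \<lfloor>Kn r n powr (r - 1)\<rfloor>"

(* The number of cells [l (j-1), l j), j \<ge> 1, of the construction below that lie in [0,1],
   where the cell length l is 1 / Kn powr (r - 1) for r < 2 and 4 / Kn for r = 2. For r = 2
   this is about Mn / 4: the remaining f_j with j > Nn + 1 are perturbed only to the right
   of 1, so they coincide with f_0 on [0,1]. *)
definition Nn :: "real \<Rightarrow> nat \<Rightarrow> nat" where
  "Nn r n = (if r < 2 then Mn r n else nat \<lfloor>Kn r n / 4\<rfloor>)"

definition Lbar :: "real \<Rightarrow> real \<Rightarrow> real \<Rightarrow> real \<Rightarrow> real" where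
  "Lbar r L c0 p =
     (if r < 2 then min (L / 4) (sqrt (c0 * (r - 1) / (12 * p)))
      else min L (sqrt (c0 / (12 * p))))"

text \<open>In the four functions below, \<open>K\<close>, \<open>\<gamma>\<close> and \<open>B\<close> stand for $K_n$, $\gamma$ and $\bar L$.\<close>

(* i is the index of the cell [i / K^\<gamma>, (i+1) / K^\<gamma>) that contains x *)
definition base_lt1 :: "real \<Rightarrow> real \<Rightarrow> real \<Rightarrow> real \<Rightarrow> real" where
  "base_lt1 \<gamma> K B x =
     (let i = real_of_int \<lfloor>x * K powr \<gamma>\<rfloor>; a = i / K powr \<gamma> in
      if x < a + 1 / K then 2 * i * B * K powr (- \<gamma>) + B * K powr (1 - \<gamma>) * (x - a)
      else if x < a + 3 / K then (2 * i + 1) * B * K powr (- \<gamma>)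
      else if x < a + 4 / K
        then (2 * i + 1) * B * K powr (- \<gamma>) + B * K powr (1 - \<gamma>) * (x - (a + 3 / K))
      else 2 * (i + 1) * B * K powr (- \<gamma>))"

definition pert_lt1 :: "real \<Rightarrow> real \<Rightarrow> real \<Rightarrow> nat \<Rightarrow> real \<Rightarrow> real" where
  "pert_lt1 \<gamma> K B j x =
     (let a = (real j - 1) / K powr \<gamma> in
      if j \<ge> 1 \<and> a \<le> x \<and> x < real j / K powr \<gamma> then
        (if x < a + 1 / K then 2 * (real j - 1) * B * K powr (- \<gamma>)
         else if x < a + 3 / K
           then 2 * (real j - 1) * B * K powr (- \<gamma>) + B * K powr (1 - \<gamma>) * (x - (a + 1 / K))
         else 2 * real j * B * K powr (- \<gamma>))
      else base_lt1 \<gamma> K B x)"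

(* i is the index of the cell [4 i / K, 4 (i+1) / K) that contains x *)
definition base_eq1 :: "real \<Rightarrow> real \<Rightarrow> real \<Rightarrow> real" where
  "base_eq1 K B x =
     (let i = real_of_int \<lfloor>x * K / 4\<rfloor> in
      if x < (4 * i + 1) / K then B * (2 * i / K) + B * (x - 4 * i / K)
      else if x < (4 * i + 3) / K then B * ((2 * i + 1) / K)
      else B * ((2 * i + 1) / K) + B * (x - (4 * i + 3) / K))"

definition pert_eq1 :: "real \<Rightarrow> real \<Rightarrow> nat \<Rightarrow> real \<Rightarrow> real" where
  "pert_eq1 K B j x =
     (if j \<ge> 1 \<and> 4 * (real j - 1) / K \<le> x \<and> x < 4 * real j / K then
        (if x < (4 * real j - 3) / K then B * (2 * (real j - 1) / K)
         else if x < (4 * real j - 1) / K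
           then B * (2 * (real j - 1) / K) + B * (x - (4 * real j - 3) / K)
         else B * (2 * real j / K))
      else base_eq1 K B x)"

definition gbar :: "real \<Rightarrow> real \<Rightarrow> real \<Rightarrow> real \<Rightarrow> nat \<Rightarrow> nat \<Rightarrow> real \<Rightarrow> real" where
  "gbar r L c0 p j n =
     (if r < 2 then pert_lt1 (r - 1) (Kn r n) (Lbar r L c0 p) j
      else pert_eq1 (Kn r n) (Lbar r L c0 p) j)"

(* only the values at x in [0,1] matter *)
definition fjn :: "real \<Rightarrow> real \<Rightarrow> real \<Rightarrow> real \<Rightarrow> nat \<Rightarrow> nat \<Rightarrow> real \<Rightarrow> real" where
  "fjn r L c0 p j n x = integral {0..x} (gbar r L c0 p j n)"

(* the joint law of the observations f(i/n) + \<xi> i, i = 1, ..., n *)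
definition obs_law ::
    "'a measure \<Rightarrow> (nat \<Rightarrow> 'a \<Rightarrow> real) \<Rightarrow> nat \<Rightarrow> (real \<Rightarrow> real) \<Rightarrow> (nat \<Rightarrow> real) measure" where
  "obs_law \<Omega> \<xi> n f =
     distr \<Omega> (\<Pi>\<^sub>M i\<in>{1..n}. borel) (\<lambda>\<omega>. \<lambda>i\<in>{1..n}. f (real i / real n) + \<xi> i \<omega>)"

end

theory Submission
  imports Defs "HOL-Real_Asymp.Real_Asymp"
begin

text \<open>On \<open>[0,1]\<close> every \<open>g\<^sub>j\<close> is a finite sum of translated profiles, each constant outside a window
  of length \<open>4/K\<close> and rising there by \<open>2/K\<close>, scaled by a slope \<open>S\<close>. Continuity, monotonicity and an
  explicit primitive can therefore be read off cell by cell, and \<open>f\<^sub>0 - f\<^sub>j\<close> is a single nonnegative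
  bump of height \<open>S/K\<^sup>2 = B K powr (- r)\<close> supported in the \<open>j\<close>-th window; this gives the separation.
  The Hoelder condition follows from the Lipschitz constant \<open>S\<close> at scales below \<open>1/K\<close> and from
  counting cells at larger scales. For the divergence, about \<open>4 n/K\<close> design points meet the bump,
  and \<open>n K powr (- 2 r - 1) = ln n\<close>; bounding the bump by its height at all of them loses too much
  against \<open>ln M\<close>, which is about \<open>(r - 1) / (2 r + 1) * ln n\<close>, so the squared bump is majorised by
  a three-level step function.\<close>

section \<open>Profiles, their primitives and the bump\<close>

text \<open>Here \<open>h\<close> stands for \<open>1 / K\<close>, and \<open>b\<close> marks the
  perturbed cell. Writing the broken lines as sums of hinges \<open>max 0 (y - c)\<close> makes
  continuity evident and gives a primitive term by term.\<close>

definition profile :: "real \<Rightarrow> bool \<Rightarrow> real \<Rightarrow> real" where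
  "profile h b y =
     (if b then max 0 (y - h) - max 0 (y - 3 * h)
      else max 0 y - max 0 (y - h) + max 0 (y - 3 * h) - max 0 (y - 4 * h))"

definition half_square :: "real \<Rightarrow> real" where
  "half_square y = (max 0 y)\<^sup>2 / 2"

definition profile_prim :: "real \<Rightarrow> bool \<Rightarrow> real \<Rightarrow> real" where
  "profile_prim h b y =
     (if b then half_square (y - h) - half_square (y - 3 * h)
      else half_square y - half_square (y - h) + half_square (y - 3 * h) - half_square (y - 4 * h))"

text \<open>Expanded, this has the coefficients 1, -2, 2, -1 on \<open>half_square\<close> shifted
  to 0, \<open>h\<close>, \<open>3 * h\<close>, \<open>4 * h\<close>: a multiple of the quadratic
  B-spline with these knots.\<close>

definition bump :: "real \<Rightarrow> real \<Rightarrow> real" where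
  "bump h y = profile_prim h False y - profile_prim h True y"

lemma half_square_deriv: "(half_square has_real_derivative max 0 y) (at y)"
proof -
  consider "y < 0" | "y = 0" | "y > 0" by linarith
  then show ?thesis
  proof cases
    case 1
    have "((\<lambda>_. 0) has_real_derivative max 0 y) (at y)" using 1 by simp
    then show ?thesis
      by (rule has_field_derivative_transform_within_open[where S = "{..<0}"])
         (use 1 in \<open>auto simp: half_square_def\<close>)
  next
    case 2
    \<comment> \<open>The kink is handled by Caratheodory's criterion, with
      \<open>max 0 z / 2\<close> as the continuous slope function at 0.\<close>
    have "\<forall>z. half_square z - half_square y = max 0 z / 2 * (z - y)"
      by (auto simp: 2 half_square_def power2_eq_square max_def)
    moreover have "isCont (\<lambda>z. max 0 z / 2) y" by (intro continuous_intros) auto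
    ultimately show ?thesis
      unfolding CARAT_DERIV by (intro exI[where x = "\<lambda>z. max 0 z / 2"]) (simp add: 2)
  next
    case 3
    have "((\<lambda>z. z\<^sup>2 / 2) has_real_derivative max 0 y) (at y)"
      using 3 by (auto intro!: derivative_eq_intros)
    then show ?thesis
      by (rule has_field_derivative_transform_within_open[where S = "{0<..}"])
         (use 3 in \<open>auto simp: half_square_def\<close>)
  qed
qed

lemma profile_prim_deriv: "(profile_prim h b has_real_derivative profile h b y) (at y)"
proof -
  have q: "((\<lambda>z. half_square (z - c)) has_real_derivative max 0 (y - c)) (at y)" for c
  proof -
    have "((\<lambda>z. z - c) has_real_derivative 1) (at y)" by (auto intro!: derivative_eq_intros)
    from DERIV_chain2[OF half_square_deriv this] show ?thesis by simp
  qed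
  show ?thesis
    unfolding profile_prim_def[abs_def] profile_def
    by (cases b) (auto intro!: derivative_eq_intros q q[of 0, simplified])
qed

lemma profile_mono: "0 < h \<Longrightarrow> x \<le> y \<Longrightarrow> profile h b x \<le> profile h b y"
  unfolding profile_def by (cases b) (auto simp: max_def)

text \<open>The profile has slopes 0 and 1 only, and slope 1 only inside \<open>{0..4 * h}\<close>,
  where the ramp \<open>max 0 x - max 0 (x - l)\<close> has slope 1 as well.\<close>

lemma clamp_minus_profile_mono:
  assumes "0 < h" "4 * h \<le> l" "x \<le> y"
  shows "max 0 x - max 0 (x - l) - profile h b x \<le> max 0 y - max 0 (y - l) - profile h b y"
  using assms unfolding profile_def by (cases b) (auto simp: max_def)

lemma profile_nonpos: "0 < h \<Longrightarrow> y \<le> 0 \<Longrightarrow> profile h b y = 0"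
  by (auto simp: profile_def)

lemma profile_saturated: "0 < h \<Longrightarrow> 4 * h \<le> y \<Longrightarrow> profile h b y = 2 * h"
  by (auto simp: profile_def)

lemma profile_le: "0 < h \<Longrightarrow> profile h b y \<le> 2 * h"
  by (auto simp: profile_def max_def)

lemma profile_nonneg: "0 < h \<Longrightarrow> 0 \<le> profile h b y"
  by (auto simp: profile_def max_def)

lemma profile_prim_nonpos: "0 < h \<Longrightarrow> y \<le> 0 \<Longrightarrow> profile_prim h b y = 0"
  by (simp add: profile_prim_def half_square_def)

text \<open>Both profiles enclose the same area \<open>4 * h\<^sup>2\<close> over the window and
  agree outside it, so the two primitives meet again at \<open>4 * h\<close>.\<close>

lemma bump_outside: "0 < h \<Longrightarrow> y \<le> 0 \<or> 4 * h \<le> y \<Longrightarrow> bump h y = 0"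
  by (auto simp: bump_def profile_prim_def half_square_def max_def power2_eq_square field_simps)

lemma bump_peak: "0 < h \<Longrightarrow> bump h (2 * h) = h\<^sup>2"
  by (auto simp: bump_def profile_prim_def half_square_def max_def power2_eq_square field_simps)

text \<open>Each profile is point symmetric about its value \<open>h\<close> at
  \<open>2 * h\<close>, so their difference is odd and its primitive even about that point. Only the
  left half remains to be estimated.\<close>

lemma bump_reflect: "0 < h \<Longrightarrow> bump h (4 * h - y) = bump h y"
  by (auto simp: bump_def profile_prim_def half_square_def max_def power2_eq_square field_simps)

lemma bump_left:
  assumes "0 < h" "0 \<le> y" "y \<le> 2 * h"
  shows "bump h y = (if y \<le> h then y\<^sup>2 / 2 else h\<^sup>2 - (2 * h - y)\<^sup>2 / 2)"
  using assms
  by (auto simp: bump_def profile_prim_def half_square_def max_def power2_eq_square field_simps)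

text \<open>The levels are the values of the bump at \<open>2 * h\<close>, \<open>h\<close> and
  \<open>h / 2\<close>; it is nondecreasing on the left half.\<close>

lemma bump_bounds_left:
  assumes "0 < h" "y \<le> 2 * h"
  shows "0 \<le> bump h y" "bump h y \<le> h\<^sup>2"
    "y \<le> h \<Longrightarrow> bump h y \<le> h\<^sup>2 / 2" "y \<le> h / 2 \<Longrightarrow> bump h y \<le> h\<^sup>2 / 8"
proof -
  have "0 \<le> bump h y \<and> bump h y \<le> h\<^sup>2 \<and> (y \<le> h \<longrightarrow> bump h y \<le> h\<^sup>2 / 2) \<and> (y \<le> h / 2 \<longrightarrow> bump h y \<le> h\<^sup>2 / 8)"
  proof (cases "y \<le> 0")
    case True
    then show ?thesis using assms by (simp add: bump_outside)
  next
    case False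
    have sq: "0 \<le> y\<^sup>2" "0 \<le> (2 * h - y)\<^sup>2" "0 \<le> h\<^sup>2" by auto
    consider "y \<le> h / 2" | "h / 2 < y" "y \<le> h" | "h < y" by linarith
    then show ?thesis
    proof cases
      case 1
      then have "y\<^sup>2 \<le> (h / 2)\<^sup>2" using False by (intro power_mono) auto
      then have "y\<^sup>2 \<le> h\<^sup>2 / 4" by (simp add: power_divide)
      moreover have "bump h y = y\<^sup>2 / 2" using 1 False assms by (simp add: bump_left)
      ultimately show ?thesis using sq by linarith
    next
      case 2
      then have "y\<^sup>2 \<le> h\<^sup>2" using False by (intro power_mono) auto
      moreover have "bump h y = y\<^sup>2 / 2" using 2 False assms by (simp add: bump_left)
      ultimately show ?thesis using sq 2 by linarith
    next
      case 3
      then have "(2 * h - y)\<^sup>2 \<le> h\<^sup>2" using assms by (intro power_mono) auto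
      moreover have "bump h y = h\<^sup>2 - (2 * h - y)\<^sup>2 / 2" using 3 False assms by (simp add: bump_left)
      ultimately show ?thesis using sq 3 assms(1) by linarith
    qed
  qed
  then show "0 \<le> bump h y" "bump h y \<le> h\<^sup>2"
    "y \<le> h \<Longrightarrow> bump h y \<le> h\<^sup>2 / 2" "y \<le> h / 2 \<Longrightarrow> bump h y \<le> h\<^sup>2 / 8" by auto
qed

lemma bump_nonneg: "0 < h \<Longrightarrow> 0 \<le> bump h y"
  using bump_bounds_left(1)[of h y] bump_bounds_left(1)[of h "4 * h - y"]
  by (cases "y \<le> 2 * h") (auto simp: bump_reflect)

lemma bump_le: "0 < h \<Longrightarrow> bump h y \<le> h\<^sup>2"
  using bump_bounds_left(2)[of h y] bump_bounds_left(2)[of h "4 * h - y"]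
  by (cases "y \<le> 2 * h") (auto simp: bump_reflect)

text \<open>The budget in \<open>eventually_kullback_budget\<close> requires the step function on the right to have
  integral below \<open>12/5 h^5\<close>. The two levels \<open>h^2\<close> and \<open>h^2/2\<close> alone would give \<open>5/2 h^5\<close>; a third
  one reduces it to \<open>145/64 h^5\<close>.\<close>
lemma bump_square_le:
  assumes h: "0 < h"
  shows "(bump h y)\<^sup>2 \<le> h ^ 4 * (1 / 64 * indicator {0..4 * h} y
      + 15 / 64 * indicator {h / 2..7 * h / 2} y + 3 / 4 * indicator {h..3 * h} y)"
proof -
  \<comment> \<open>The weights accumulate to \<open>(1/8)^2\<close>, \<open>(1/2)^2\<close> and
    \<open>1\<close>, the squares of the three levels, as \<open>y\<close> moves towards the
    centre.\<close>
  have half: "(bump h y)\<^sup>2 \<le> h ^ 4 * (1 / 64 * indicator {0..4 * h} y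
      + 15 / 64 * indicator {h / 2..7 * h / 2} y + 3 / 4 * indicator {h..3 * h} y)"
    if y: "y \<le> 2 * h" for y
  proof -
    have sq: "(bump h y)\<^sup>2 \<le> h ^ 4 * c\<^sup>2" if "bump h y \<le> h\<^sup>2 * c" for c
      using power_mono[OF that bump_nonneg[OF h], of 2] by (simp add: power_mult_distrib)
    consider "y < 0" | "0 \<le> y" "y < h / 2" | "h / 2 \<le> y" "y < h" | "h \<le> y" by linarith
    then show ?thesis
    proof cases
      case 1 then show ?thesis using h by (simp add: bump_outside indicator_def)
    next
      case 2 then show ?thesis
        using h y bump_bounds_left(4)[OF h y] sq[of "1 / 8"] by (simp add: indicator_def power2_eq_square)
    next
      case 3 then show ?thesis
        using h y bump_bounds_left(3)[OF h y] sq[of "1 / 2"] by (simp add: indicator_def power2_eq_square)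
    next
      case 4 then show ?thesis
        using h y bump_le[OF h, of y] sq[of 1] by (simp add: indicator_def)
    qed
  qed
  show ?thesis
  proof (cases "y \<le> 2 * h")
    case True then show ?thesis by (rule half)
  next
    case False
    \<comment> \<open>The three windows are centred at \<open>2 * h\<close>, hence invariant under
      the reflection.\<close>
    have "indicator {0..4 * h} (4 * h - y) = (indicator {0..4 * h} y :: real)"
      "indicator {h / 2..7 * h / 2} (4 * h - y) = (indicator {h / 2..7 * h / 2} y :: real)"
      "indicator {h..3 * h} (4 * h - y) = (indicator {h..3 * h} y :: real)"
      by (auto simp: indicator_def)
    then show ?thesis using half[of "4 * h - y"] False h by (simp add: bump_reflect)
  qed
qed

section \<open>Counting design points\<close>

lemma card_nat_interval_le:
  fixes A :: "nat set" and u v :: real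
  assumes "\<And>i. i \<in> A \<Longrightarrow> u \<le> real i \<and> real i \<le> v" "u \<le> v"
  shows "real (card A) \<le> v - u + 1"
proof -
  have "int ` A \<subseteq> {\<lceil>u\<rceil>..\<lfloor>v\<rfloor>}"
    using assms(1) by (force simp: ceiling_le_iff le_floor_iff)
  then have "card (int ` A) \<le> card {\<lceil>u\<rceil>..\<lfloor>v\<rfloor>}" by (intro card_mono) auto
  then have "card A \<le> nat (\<lfloor>v\<rfloor> - \<lceil>u\<rceil> + 1)" by (simp add: card_image)
  then have "int (card A) \<le> max 0 (\<lfloor>v\<rfloor> - \<lceil>u\<rceil> + 1)" by linarith
  then have "real_of_int (int (card A)) \<le> real_of_int (max 0 (\<lfloor>v\<rfloor> - \<lceil>u\<rceil> + 1))"
    by (simp only: of_int_le_iff)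
  moreover have "real_of_int \<lfloor>v\<rfloor> \<le> v" "u \<le> real_of_int \<lceil>u\<rceil>" by auto
  ultimately show ?thesis using assms(2) by (cases "0 \<le> \<lfloor>v\<rfloor> - \<lceil>u\<rceil> + 1") linarith+
qed

lemma sum_indicator_grid_le:
  fixes a u v :: real
  assumes "u \<le> v" "0 < n"
  shows "(\<Sum>i=1..n. indicator {u..v} (real i / real n - a)) \<le> real n * (v - u) + 1"
proof -
  let ?A = "{i \<in> {1..n}. real i / real n - a \<in> {u..v}}"
  have "(\<Sum>i=1..n. indicator {u..v} (real i / real n - a)) = real (card ?A)"
    by (simp add: indicator_def sum.If_cases Int_def)
  also have "\<dots> \<le> real n * (v + a) - real n * (u + a) + 1"
    using assms by (intro card_nat_interval_le) (auto simp: field_simps)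
  finally show ?thesis by (simp add: algebra_simps)
qed

text \<open>\<open>145/64 = 4 * 1/64 + 3 * 15/64 + 2 * 3/4\<close> is the weighted length of the
  three windows in units of \<open>h\<close>. Each window may catch one extra grid point, and the
  weights add up to 1.\<close>

lemma sum_bump_square_le:
  assumes h: "0 < h" and n: "0 < n"
  shows "(\<Sum>i=1..n. (bump h (real i / real n - a))\<^sup>2) \<le> h ^ 4 * (145 / 64 * (real n * h) + 1)"
proof -
  let ?y = "\<lambda>i. real i / real n - a"
  let ?I = "\<lambda>u v. \<Sum>i=1..n. indicator {u..v} (?y i) :: real"
  have "(\<Sum>i=1..n. (bump h (?y i))\<^sup>2) \<le> (\<Sum>i=1..n. h ^ 4 * (1 / 64 * indicator {0..4 * h} (?y i)
      + 15 / 64 * indicator {h / 2..7 * h / 2} (?y i) + 3 / 4 * indicator {h..3 * h} (?y i)))"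
    by (intro sum_mono bump_square_le h)
  also have "\<dots> = h ^ 4 * (1 / 64 * ?I 0 (4 * h) + 15 / 64 * ?I (h / 2) (7 * h / 2) + 3 / 4 * ?I h (3 * h))"
    by (simp only: sum_distrib_left[symmetric] sum.distrib)
  also have "\<dots> \<le> h ^ 4 * (145 / 64 * (real n * h) + 1)"
  proof -
    have "?I 0 (4 * h) \<le> 4 * (real n * h) + 1" "?I (h / 2) (7 * h / 2) \<le> 3 * (real n * h) + 1"
      "?I h (3 * h) \<le> 2 * (real n * h) + 1"
      using sum_indicator_grid_le[of 0 "4 * h" n a] sum_indicator_grid_le[of "h / 2" "7 * h / 2" n a]
        sum_indicator_grid_le[of h "3 * h" n a] h n by (auto simp: algebra_simps)
    then show ?thesis using h by (intro mult_left_mono) auto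
  qed
  finally show ?thesis .
qed

section \<open>Staircases made of profiles\<close>

text \<open>Cells are numbered from 0 but perturbations from 1, hence \<open>Suc i = j\<close>; the
  index 0 leaves every cell unperturbed.\<close>

definition stair :: "real \<Rightarrow> real \<Rightarrow> real \<Rightarrow> nat \<Rightarrow> nat \<Rightarrow> real \<Rightarrow> real" where
  "stair S h l N j x = S * (\<Sum>i<N. profile h (Suc i = j) (x - real i * l))"

definition stair_prim :: "real \<Rightarrow> real \<Rightarrow> real \<Rightarrow> nat \<Rightarrow> nat \<Rightarrow> real \<Rightarrow> real" where
  "stair_prim S h l N j x = S * (\<Sum>i<N. profile_prim h (Suc i = j) (x - real i * l))"

text \<open>Common frame for \<open>r < 2\<close> and \<open>r = 2\<close>: each cell of length
  \<open>l\<close> has a window of length \<open>4 * h\<close> at its left end. The strict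
  \<open>1 < real N * l\<close> gives also the point 1 a cell of index below
  \<open>N\<close>.\<close>

locale staircase =
  fixes S h l :: real and N :: nat
  assumes S: "0 < S" and h: "0 < h" and hl: "4 * h \<le> l" and N: "1 < real N * l"
begin

lemma l: "0 < l"
  using h hl by linarith

lemma stair_prim_deriv: "(stair_prim S h l N j has_real_derivative stair S h l N j x) (at x)"
proof -
  have "((\<lambda>z. profile_prim h b (z - c)) has_real_derivative profile h b (x - c)) (at x)" for b c
  proof -
    have "((\<lambda>z. z - c) has_real_derivative 1) (at x)" by (auto intro!: derivative_eq_intros)
    from DERIV_chain2[OF profile_prim_deriv this] show ?thesis by simp
  qed
  then show ?thesis
    unfolding stair_prim_def[abs_def] stair_def by (intro DERIV_cmult DERIV_sum) auto
qed

lemma stair_mono: "x \<le> y \<Longrightarrow> stair S h l N j x \<le> stair S h l N j y"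
  unfolding stair_def using S h by (intro mult_left_mono sum_mono profile_mono) auto

lemma sum_clamp:
  assumes "0 \<le> x" "x \<le> real N * l"
  shows "(\<Sum>i<N. max 0 (x - real i * l) - max 0 (x - real i * l - l)) = x"
proof -
  have "(\<Sum>i<N. max 0 (x - real i * l) - max 0 (x - real i * l - l))
      = (\<Sum>i<N. max 0 (x - real i * l) - max 0 (x - real (Suc i) * l))"
    by (intro sum.cong) (auto simp: algebra_simps)
  also have "\<dots> = max 0 x - max 0 (x - real N * l)"
    by (subst sum_lessThan_telescope') simp
  finally show ?thesis using assms by simp
qed

text \<open>The ramps of length \<open>l\<close> in \<open>sum_clamp\<close> partition \<open>x\<close> into cells, so \<open>S x - stair x\<close> is a
  sum of nondecreasing functions.\<close>
lemma stair_lipschitz: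
  assumes "0 \<le> x" "x \<le> y" "y \<le> 1"
  shows "stair S h l N j y - stair S h l N j x \<le> S * (y - x)"
proof -
  let ?c = "\<lambda>x i. max 0 (x - real i * l) - max 0 (x - real i * l - l)"
  let ?p = "\<lambda>x i. profile h (Suc i = j) (x - real i * l)"
  have "(\<Sum>i<N. ?c x i - ?p x i) \<le> (\<Sum>i<N. ?c y i - ?p y i)"
    using assms h hl by (intro sum_mono clamp_minus_profile_mono) auto
  then have "x - (\<Sum>i<N. ?p x i) \<le> y - (\<Sum>i<N. ?p y i)"
    using assms N by (simp only: sum_subtractf[of "?c x"] sum_subtractf[of "?c y"] sum_clamp)
  then have "(\<Sum>i<N. ?p y i) - (\<Sum>i<N. ?p x i) \<le> y - x" by linarith
  from mult_left_mono[OF this, of S] show ?thesis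
    using S by (simp add: stair_def right_diff_distrib)
qed

text \<open>Cells to the left are saturated and contribute \<open>2 * h\<close> each, those to the
  right have not started, so only the \<open>k\<close>-th profile varies.\<close>

lemma stair_cell:
  assumes k: "k < N" and x: "real k * l \<le> x" "x \<le> real (Suc k) * l"
  shows "stair S h l N j x = S * (2 * h * real k + profile h (Suc k = j) (x - real k * l))"
proof -
  let ?p = "\<lambda>i. profile h (Suc i = j) (x - real i * l)"
  have below: "?p i = 2 * h" if "i < k" for i
  proof (rule profile_saturated[OF h])
    have "real (Suc i) * l \<le> real k * l" using that l by (intro mult_right_mono) auto
    then show "4 * h \<le> x - real i * l" using x hl by (simp add: algebra_simps)
  qed
  have above: "?p i = 0" if "k < i" for i
  proof (rule profile_nonpos[OF h])
    have "real (Suc k) * l \<le> real i * l" using that l by (intro mult_right_mono) auto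
    then show "x - real i * l \<le> 0" using x by linarith
  qed
  have "(\<Sum>i<N. ?p i) = (\<Sum>i<N. (if i < k then 2 * h else 0) + (if i = k then ?p k else 0))"
    using below above by (intro sum.cong) (auto simp: not_less_iff_gr_or_eq)
  also have "\<dots> = (\<Sum>i<N. (if i < k then 2 * h else 0)) + ?p k"
    using k by (simp add: sum.distrib)
  also have "(\<Sum>i<N. (if i < k then 2 * h else 0)) = (\<Sum>i<k. 2 * h)"
    using k by (intro sum.mono_neutral_cong_right) auto
  finally show ?thesis by (simp add: stair_def algebra_simps)
qed

lemma cell_index:
  assumes "0 \<le> x" "x \<le> 1"
  shows "nat \<lfloor>x / l\<rfloor> < N" "real (nat \<lfloor>x / l\<rfloor>) * l \<le> x" "x < real (Suc (nat \<lfloor>x / l\<rfloor>)) * l"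
proof -
  have e: "real (nat \<lfloor>x / l\<rfloor>) = of_int \<lfloor>x / l\<rfloor>" using assms l by simp
  have a: "of_int \<lfloor>x / l\<rfloor> \<le> x / l" "x / l < of_int \<lfloor>x / l\<rfloor> + 1" by linarith+
  have "x / l < real N" using assms l N by (simp add: field_simps)
  then have "real (nat \<lfloor>x / l\<rfloor>) < real N" using a e by linarith
  then show "nat \<lfloor>x / l\<rfloor> < N" by simp
  show "real (nat \<lfloor>x / l\<rfloor>) * l \<le> x" using a(1) l unfolding e by (simp only: pos_le_divide_eq)
  show "x < real (Suc (nat \<lfloor>x / l\<rfloor>)) * l"
    using a(2) l unfolding of_nat_Suc e by (simp only: pos_divide_less_eq add.commute)
qed

text \<open>As an inequality this also covers \<open>k > N\<close>, where the finite sum has stopped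
  growing; such grid points occur in \<open>stair_increment_le\<close>.\<close>

lemma stair_grid_le: "stair S h l N j (real k * l) \<le> S * (2 * h * real k)"
proof -
  have "(\<Sum>i<N. profile h (Suc i = j) (real k * l - real i * l)) \<le> (\<Sum>i<N. if i < k then 2 * h else 0)"
  proof (rule sum_mono)
    fix i
    show "profile h (Suc i = j) (real k * l - real i * l) \<le> (if i < k then 2 * h else 0)"
    proof (cases "i < k")
      case True then show ?thesis using profile_le[OF h] by simp
    next
      case False
      then have "real k * l \<le> real i * l" using l by (intro mult_right_mono) auto
      then show ?thesis using profile_nonpos[OF h] False by simp
    qed
  qed
  also have "\<dots> \<le> (\<Sum>i<k. 2 * h)"
  proof -
    have "(\<Sum>i<N. if i < k then 2 * h else 0) = (\<Sum>i\<in>{..<N} \<inter> {..<k}. 2 * h)"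
      by (intro sum.mono_neutral_cong_right) auto
    also have "\<dots> \<le> (\<Sum>i<k. 2 * h)" using h by (intro sum_mono2) auto
    finally show ?thesis .
  qed
  finally have "(\<Sum>i<N. profile h (Suc i = j) (real k * l - real i * l)) \<le> 2 * h * real k" by (simp add: mult.commute)
  then show ?thesis unfolding stair_def using S by (intro mult_left_mono) auto
qed

text \<open>If \<open>x\<close> lies in cell \<open>k\<close>, the stair at \<open>x\<close> has
  reached the level at the start of that cell, and \<open>y\<close> is at or left of grid point
  \<open>k + 1 + m\<close>. Each of the \<open>1 + m\<close> cells between adds at most
  \<open>2 * S * h\<close>.\<close>

lemma stair_increment_le:
  assumes "0 \<le> x" "x \<le> 1" "y \<le> x + real m * l"
  shows "stair S h l N j y - stair S h l N j x \<le> 2 * S * h * (1 + real m)"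
proof -
  define k where "k = nat \<lfloor>x / l\<rfloor>"
  have k: "k < N" "real k * l \<le> x" "x < real (Suc k) * l"
    using cell_index[OF assms(1,2)] by (auto simp: k_def)
  have "S * (2 * h * real k) \<le> stair S h l N j x"
    using k S profile_nonneg[OF h] by (subst stair_cell[OF k(1,2)]) auto
  moreover have "stair S h l N j y \<le> stair S h l N j (real (k + 1 + m) * l)"
    using assms k(3) by (intro stair_mono) (simp add: algebra_simps)
  moreover have "\<dots> \<le> S * (2 * h * real (k + 1 + m))" by (rule stair_grid_le)
  ultimately show ?thesis by (simp add: algebra_simps)
qed

lemma stair_prim_0: "stair_prim S h l N j 0 = 0"
proof -
  have "profile_prim h b (- (real i * l)) = 0" for b i
    using h l by (intro profile_prim_nonpos) auto
  then show ?thesis by (simp add: stair_prim_def)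
qed

lemma integral_stair:
  assumes "0 \<le> x" and g: "\<And>t. t \<in> {0..x} \<Longrightarrow> g t = stair S h l N j t"
  shows "integral {0..x} g = stair_prim S h l N j x"
proof -
  have "(stair S h l N j has_integral stair_prim S h l N j x - stair_prim S h l N j 0) {0..x}"
    using assms(1) stair_prim_deriv
    by (intro fundamental_theorem_of_calculus)
       (auto simp: has_real_derivative_iff_has_vector_derivative[symmetric] intro: has_field_derivative_at_within)
  then have "(g has_integral stair_prim S h l N j x) {0..x}"
    using g by (subst has_integral_cong[of _ _ "stair S h l N j"]) (auto simp: stair_prim_0)
  then show ?thesis by (rule integral_unique)
qed

lemma stair_prim_convex: "convex_on {0..1} (stair_prim S h l N j)"
  by (rule convex_on_realI[where f' = "stair S h l N j"]) (auto intro: stair_prim_deriv stair_mono)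

text \<open>Agreement is asked for on \<open>{0..1}\<close> only, which is where \<open>fjn\<close>
  gets identified. As the stair is nondecreasing, the one-sided bound \<open>H\<close> controls
  absolute differences.\<close>

lemma holder_convex_stair:
  assumes F: "\<And>x. x \<in> {0..1} \<Longrightarrow> F x = stair_prim S h l N j x"
    and H: "\<And>x y. 0 \<le> x \<Longrightarrow> x \<le> y \<Longrightarrow> y \<le> 1 \<Longrightarrow>
      stair S h l N j y - stair S h l N j x \<le> L * (y - x) powr (r - 1)"
  shows "F \<in> holder_convex r L"
proof -
  have "convex_on {0..1} F"
  proof (rule convex_onI)
    fix t x y :: real
    assume *: "0 < t" "t < 1" "x \<in> {0..1}" "y \<in> {0..1}"
    have "(1 - t) *\<^sub>R x + t *\<^sub>R y \<in> {0..1}"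
      using * by (intro convexD_alt) auto
    then show "F ((1 - t) *\<^sub>R x + t *\<^sub>R y) \<le> (1 - t) * F x + t * F y"
      using * F convex_onD[OF stair_prim_convex[of j], of t x y] by auto
  qed simp
  moreover have "(F has_real_derivative stair S h l N j x) (at x within {0..1})" if "x \<in> {0..1}" for x
    by (rule has_field_derivative_transform_within[OF has_field_derivative_at_within[OF stair_prim_deriv], where d = 1])
       (use that in \<open>auto simp: F\<close>)
  moreover have "\<bar>stair S h l N j x1 - stair S h l N j x2\<bar> \<le> L * \<bar>x1 - x2\<bar> powr (r - 1)"
    if "x1 \<in> {0..1}" "x2 \<in> {0..1}" for x1 x2
  proof (cases "x1 \<le> x2")
    case True
    then show ?thesis using H[of x1 x2] stair_mono[of x1 x2 j] that by (simp add: abs_if)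
  next
    case False
    then show ?thesis using H[of x2 x1] stair_mono[of x2 x1 j] that by (simp add: abs_if)
  qed
  ultimately show ?thesis unfolding holder_convex_def by blast
qed

text \<open>The loss of the \<open>j\<close>-th function against the unperturbed one. With the value
  0 at \<open>j = 0\<close>, any two functions differ by a difference of two such bumps.\<close>

definition cell_bump :: "nat \<Rightarrow> real \<Rightarrow> real" where
  "cell_bump j x = (if j = 0 then 0 else S * bump h (x - (real j - 1) * l))"

lemma cell_bump_nonneg: "0 \<le> cell_bump j x"
  using S bump_nonneg[OF h] by (simp add: cell_bump_def)

lemma cell_bump_le: "cell_bump j x \<le> S * h\<^sup>2"
  using S bump_le[OF h] by (simp add: cell_bump_def)

text \<open>Only the summand of index \<open>j - 1\<close> changes; \<open>j \<le> N\<close> ensures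
  that it occurs in the sum.\<close>

lemma stair_prim_eq:
  assumes "j \<le> N"
  shows "stair_prim S h l N j x = stair_prim S h l N 0 x - cell_bump j x"
proof (cases j)
  case 0
  then show ?thesis by (simp add: cell_bump_def)
next
  case (Suc m)
  have "(\<Sum>i<N. profile_prim h (Suc i = j) (x - real i * l))
      = (\<Sum>i<N. profile_prim h False (x - real i * l) - (if i = m then bump h (x - real m * l) else 0))"
    by (intro sum.cong) (auto simp: Suc bump_def)
  also have "\<dots> = (\<Sum>i<N. profile_prim h False (x - real i * l)) - bump h (x - real m * l)"
    using assms Suc by (simp add: sum_subtractf)
  finally show ?thesis unfolding stair_prim_def cell_bump_def by (simp add: Suc right_diff_distrib)
qed

lemma cell_bump_peak: "j \<noteq> 0 \<Longrightarrow> cell_bump j ((real j - 1) * l + 2 * h) = S * h\<^sup>2"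
  using bump_peak[OF h] by (simp add: cell_bump_def)

text \<open>Windows of different cells start at least \<open>l \<ge> 4 * h\<close> apart, so the
  centre of one lies outside the other.\<close>

lemma cell_bump_disjoint:
  assumes "j \<noteq> 0" "k \<noteq> j"
  shows "cell_bump k ((real j - 1) * l + 2 * h) = 0"
proof (cases "k = 0")
  case False
  define d where "d = (real j - real k) * l"
  have "d \<le> - l \<or> l \<le> d"
  proof (cases "j < k")
    case True
    then have "(real j - real k) * l \<le> (- 1) * l" using l by (intro mult_right_mono) auto
    then show ?thesis by (simp add: d_def)
  next
    case jk: False
    then have "1 * l \<le> (real j - real k) * l" using l assms by (intro mult_right_mono) auto
    then show ?thesis by (simp add: d_def)
  qed
  then have "d + 2 * h \<le> 0 \<or> 4 * h \<le> d + 2 * h" using hl h by linarith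
  then have "bump h (d + 2 * h) = 0" by (rule bump_outside[OF h])
  moreover have "(real j - 1) * l + 2 * h - (real k - 1) * l = d + 2 * h"
    by (simp add: d_def algebra_simps)
  ultimately show ?thesis unfolding cell_bump_def by (simp only: mult_zero_right if_cancel)
qed (simp add: cell_bump_def)

text \<open>Both bumps take values between 0 and \<open>S * h\<^sup>2\<close>, which bounds the
  modulus of their difference. The height is attained at the centre of a window, which lies in
  \<open>{0..1}\<close> because its cell does.\<close>

lemma sup_norm_cell_bumps:
  assumes jk: "j \<noteq> k" "real j * l \<le> 1" "real k * l \<le> 1"
    and D: "\<And>x. x \<in> {0..1} \<Longrightarrow> D x = cell_bump k x - cell_bump j x"
  shows "sup_norm D = S * h\<^sup>2"
proof -
  have ab: "\<bar>D x\<bar> \<le> S * h\<^sup>2" if "x \<in> {0..1}" for x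
    using cell_bump_nonneg[of j x] cell_bump_nonneg[of k x] cell_bump_le[of j x] cell_bump_le[of k x]
    by (simp add: D[OF that])
  have att: "\<exists>x\<in>{0..1}. \<bar>cell_bump j x - cell_bump k x\<bar> = S * h\<^sup>2"
    if "j \<noteq> 0" "k \<noteq> j" "real j * l \<le> 1" for j k
  proof
    show "(real j - 1) * l + 2 * h \<in> {0..1}"
    proof -
      have "0 \<le> (real j - 1) * l" using that l by (intro mult_nonneg_nonneg) auto
      moreover have "(real j - 1) * l \<le> 1 - l" using that by (simp add: algebra_simps)
      ultimately show ?thesis using h hl by auto
    qed
    show "\<bar>cell_bump j ((real j - 1) * l + 2 * h) - cell_bump k ((real j - 1) * l + 2 * h)\<bar> = S * h\<^sup>2"
      using S that by (simp add: cell_bump_peak cell_bump_disjoint)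
  qed
  have "\<exists>x\<in>{0..1}. \<bar>D x\<bar> = S * h\<^sup>2"
  \<comment> \<open>One of the two indices is nonzero and owns a bump; the centre of its window is
    the maximiser.\<close>
  proof (cases "j = 0")
    case True
    then show ?thesis using att[of k j] jk D by (metis)
  next
    case False
    then show ?thesis using att[of j k] jk D by (metis abs_minus_commute)
  qed
  then obtain x where "x \<in> {0..1}" "\<bar>D x\<bar> = S * h\<^sup>2" by blast
  then show ?thesis
    unfolding sup_norm_def using ab by (intro cSup_eq_maximum) (auto intro!: image_eqI[where x = x])
qed

lemma sum_cell_bump_square_le:
  assumes "0 < n"
  shows "(\<Sum>i=1..n. (cell_bump j (real i / real n))\<^sup>2) \<le> (S * h\<^sup>2)\<^sup>2 * (145 / 64 * (real n * h) + 1)"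
proof (cases "j = 0")
  case True
  then show ?thesis using h by (simp add: cell_bump_def)
next
  case False
  have "(\<Sum>i=1..n. (cell_bump j (real i / real n))\<^sup>2)
      = S\<^sup>2 * (\<Sum>i=1..n. (bump h (real i / real n - (real j - 1) * l))\<^sup>2)"
    using False by (simp add: cell_bump_def power_mult_distrib sum_distrib_left)
  also have "\<dots> \<le> S\<^sup>2 * (h ^ 4 * (145 / 64 * (real n * h) + 1))"
    by (intro mult_left_mono sum_bump_square_le h assms) auto
  finally show ?thesis by (simp add: power_mult_distrib flip: power_mult)
qed

end

section \<open>The Hoelder condition for \<open>r < 2\<close>\<close>

text \<open>Three scales of \<open>d = y - x\<close>: up to \<open>h\<close> the Lipschitz bound, up
  to \<open>l\<close> the rise over at most two cells, beyond that a count of cells. The constant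
  \<open>4 * B\<close> explains the \<open>L / 4\<close> in \<open>Lbar\<close>.\<close>

lemma (in staircase) stair_holder_lt1:
  fixes B g L :: real
  assumes g: "0 < g" "g < 1" and lh: "l = h powr g" and SB: "S = B * h powr (g - 1)"
    and ll: "2 * l \<le> l powr g" and BL: "4 * B \<le> L"
    and xy: "0 \<le> x" "x \<le> y" "y \<le> 1"
  shows "stair S h l N j y - stair S h l N j x \<le> L * (y - x) powr g"
proof -
  define d where "d = y - x"
  have d: "0 \<le> d" "d \<le> 1" using xy by (auto simp: d_def)
  have Sh: "S * h = B * l" using h by (simp add: SB lh powr_diff)
  have B: "0 < B" using S h by (simp add: SB zero_less_mult_iff)
  have "stair S h l N j y - stair S h l N j x \<le> 4 * B * d powr g"
  proof (cases "d \<le> h")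
    case True
    have "S * d \<le> B * d powr g"
    proof (cases "d = 0")
      case False
      \<comment> \<open>Passing to reciprocals turns the negative exponent \<open>g - 1\<close> into
        the positive \<open>1 - g\<close>, for which \<open>powr\<close> is monotone.\<close>
      then have "(1 / h) powr (1 - g) \<le> (1 / d) powr (1 - g)"
        using True d h g by (intro powr_mono2) (auto simp: field_simps)
      then have "h powr (g - 1) \<le> d powr (g - 1)"
        using False d h by (simp add: powr_divide powr_diff field_simps)
      then have "B * h powr (g - 1) * d \<le> B * d powr (g - 1) * d"
        using B d by (intro mult_right_mono mult_left_mono) auto
      then show ?thesis using False d by (simp add: SB powr_diff)
    qed simp
    moreover have "0 \<le> B * d powr g" using B by simp
    ultimately show ?thesis using stair_lipschitz[OF xy, of j] by (simp add: d_def)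
  next
    case dh: False
    show ?thesis
    proof (cases "d \<le> l")
      case True
      then have "stair S h l N j y - stair S h l N j x \<le> 2 * S * h * (1 + real 1)"
        using xy by (intro stair_increment_le) (auto simp: d_def)
      also have "\<dots> = 4 * B * l" using Sh by simp
      also have "\<dots> \<le> 4 * B * d powr g"
        using B dh h g unfolding lh by (intro mult_left_mono powr_mono2) auto
      finally show ?thesis .
    next
      case False
      define m where "m = nat \<lceil>d / l\<rceil>"
      have m: "d / l \<le> real m" "real m \<le> d / l + 1"
        using d l unfolding m_def by (auto intro: real_nat_ceiling_ge)
      have "stair S h l N j y - stair S h l N j x \<le> 2 * S * h * (1 + real m)"
        using xy m(1) l by (intro stair_increment_le) (auto simp: d_def field_simps)
      also have "\<dots> \<le> 2 * S * h * (2 + d / l)"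
        using m(2) S h by (intro mult_left_mono) auto
      also have "\<dots> = 2 * (S * h) * (2 + d / l)" by simp
      also have "\<dots> = 4 * B * l + 2 * B * d"
        unfolding Sh using l by (simp add: field_simps)
      \<comment> \<open>The rounding cost \<open>4 * B * l\<close> is absorbed through
        \<open>ll\<close>, the linear term because \<open>d \<le> 1\<close> and
        \<open>g < 1\<close>.\<close>
      also have "\<dots> \<le> 2 * B * d powr g + 2 * B * d powr g"
      proof (rule add_mono)
        have "l powr g \<le> d powr g" using False l g by (intro powr_mono2) auto
        then have "2 * l \<le> d powr g" using ll by linarith
        from mult_left_mono[OF this, of "2 * B"] show "4 * B * l \<le> 2 * B * d powr g" using B by simp
        have "d powr 1 \<le> d powr g" using d g by (intro powr_mono') auto
        then show "2 * B * d \<le> 2 * B * d powr g" using B d by (intro mult_left_mono) auto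
      qed
      finally show ?thesis by simp
    qed
  qed
  also have "\<dots> \<le> L * d powr g" using BL by (intro mult_right_mono) auto
  finally show ?thesis by (simp add: d_def)
qed

section \<open>Identifying the constructed functions with staircases\<close>

lemma profile_base:
  "0 < h \<Longrightarrow> 0 \<le> y \<Longrightarrow> profile h False y =
    (if y < h then y else if y < 3 * h then h else if y < 4 * h then y - 2 * h else 2 * h)"
  by (simp add: profile_def max_def)

lemma profile_pert:
  "0 < h \<Longrightarrow> 0 \<le> y \<Longrightarrow> profile h True y =
    (if y < h then 0 else if y < 3 * h then y - h else 2 * h)"
  by (simp add: profile_def max_def)

text \<open>With \<open>k\<close> the cell of \<open>x\<close>, both sides become the level
  \<open>2 * real k * v\<close> plus \<open>S\<close> times a profile of the offset
  \<open>y\<close>. The branches are then those of \<open>profile_base\<close> and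
  \<open>profile_pert\<close>, and \<open>x\<close> lies in the \<open>j\<close>-th cell only if
  \<open>j = Suc k\<close>.\<close>

lemma pert_lt1_eq_stair:
  assumes st: "staircase S h l N" and K: "0 < K"
    and SK: "S = B * K powr (1 - g)" and hK: "h = 1 / K" and lK: "l = 1 / K powr g"
    and x: "0 \<le> x" "x \<le> 1"
  shows "pert_lt1 g K B j x = stair S h l N j x"
proof -
  interpret staircase S h l N by (rule st)
  define k where "k = nat \<lfloor>x / l\<rfloor>"
  define y where "y = x - real k * l"
  define v where "v = B * K powr (- g)"
  have k: "k < N" "real k * l \<le> x" "x < real (Suc k) * l"
    using cell_index[OF x] by (auto simp: k_def)
  have fl: "real_of_int \<lfloor>x * K powr g\<rfloor> = real k"
    using x by (simp add: k_def lK)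
  have y0: "0 \<le> y" using k by (simp add: y_def)
  have Sh: "S * h = v" using K by (simp add: SK hK v_def powr_diff powr_minus field_simps)
  have stair: "stair S h l N j x = 2 * real k * v + S * profile h (Suc k = j) y"
    using stair_cell[of k x j] k Sh by (simp add: y_def algebra_simps)
  have a: "real k / K powr g = x - y" by (simp add: y_def lK)
  have base: "base_lt1 g K B x = 2 * real k * v + S * profile h False y"
  proof -
    have "base_lt1 g K B x = (if y < h then 2 * real k * v + S * y
      else if y < 3 * h then 2 * real k * v + v
      else if y < 4 * h then 2 * real k * v + v + S * (y - 3 * h) else 2 * real k * v + 2 * v)"
      unfolding base_lt1_def Let_def fl a SK[symmetric] by (simp add: v_def hK algebra_simps)
    then show ?thesis using y0 h Sh[symmetric]
      by (auto simp: profile_base algebra_simps)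
  qed
  show ?thesis
  proof (cases "j = Suc k")
    case True
    have "pert_lt1 g K B j x = (if y < h then 2 * real k * v
       else if y < 3 * h then 2 * real k * v + S * (y - h) else 2 * real k * v + 2 * v)"
      using k True y0 unfolding pert_lt1_def Let_def SK[symmetric]
      by (simp add: a lK v_def hK algebra_simps)
    then show ?thesis using y0 h Sh[symmetric] True stair
      by (auto simp: profile_pert algebra_simps)
  next
    case False
    have "\<not> (j \<ge> 1 \<and> (real j - 1) / K powr g \<le> x \<and> x < real j / K powr g)"
    proof
      assume *: "j \<ge> 1 \<and> (real j - 1) / K powr g \<le> x \<and> x < real j / K powr g"
      then have "(real j - 1) * l < real (Suc k) * l" "real k * l < real j * l"
        using k by (auto simp: lK)
      then have "real j - 1 < real (Suc k)" "real k < real j"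
        using l by (auto simp: mult_less_cancel_right)
      then show False using False by linarith
    qed
    then have "pert_lt1 g K B j x = base_lt1 g K B x" unfolding pert_lt1_def Let_def by (simp only: if_False)
    moreover have "(Suc k = j) = False" using False by auto
    ultimately show ?thesis using base stair by simp
  qed
qed

lemma pert_eq1_eq_stair:
  assumes st: "staircase B h l N" and K: "0 < K"
    and hK: "h = 1 / K" and lK: "l = 4 / K"
    and x: "0 \<le> x" "x \<le> 1"
  shows "pert_eq1 K B j x = stair B h l N j x"
proof -
  interpret staircase B h l N by (rule st)
  define k where "k = nat \<lfloor>x / l\<rfloor>"
  define y where "y = x - real k * l"
  have k: "k < N" "real k * l \<le> x" "x < real (Suc k) * l"
    using cell_index[OF x] by (auto simp: k_def)
  have fl: "real_of_int \<lfloor>x * K / 4\<rfloor> = real k"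
    using x K by (simp add: k_def lK)
  \<comment> \<open>Cells of length exactly \<open>4 * h\<close> exclude the saturated branch of
    \<open>profile_base\<close>, matching the three branches of \<open>base_eq1\<close>.\<close>
  have y0: "0 \<le> y" and y4: "y < 4 * h" using k by (auto simp: y_def lK hK algebra_simps add_divide_distrib)
  have xy: "x = y + 4 * (real k / K)" by (simp add: y_def lK)
  have stair: "stair B h l N j x = B * (2 * h * real k + profile h (Suc k = j) y)"
    using stair_cell[of k x j] k by (simp add: y_def)
  have base: "base_eq1 K B x = B * (2 * h * real k + profile h False y)"
    using y0 y4 h unfolding base_eq1_def Let_def fl unfolding xy
    by (auto simp: profile_base hK algebra_simps add_divide_distrib diff_divide_distrib)
  show ?thesis
  proof (cases "j = Suc k")
    case True
    then show ?thesis using y0 y4 h unfolding pert_eq1_def stair unfolding xy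
      by (auto simp: profile_pert hK algebra_simps add_divide_distrib diff_divide_distrib)
  next
    case False
    have "\<not> (j \<ge> 1 \<and> 4 * (real j - 1) / K \<le> x \<and> x < 4 * real j / K)"
    proof
      assume *: "j \<ge> 1 \<and> 4 * (real j - 1) / K \<le> x \<and> x < 4 * real j / K"
      then have "(real j - 1) * l < real (Suc k) * l" "real k * l < real j * l"
        using k by (auto simp: lK mult.commute)
      then have "real j - 1 < real (Suc k)" "real k < real j"
        using l by (auto simp: mult_less_cancel_right)
      then show False using False by linarith
    qed
    then have "pert_eq1 K B j x = base_eq1 K B x" unfolding pert_eq1_def by (simp only: if_False)
    moreover have "(Suc k = j) = False" using False by auto
    ultimately show ?thesis using base stair by simp
  qed
qed

section \<open>The constant \<open>Lbar\<close> and the cell geometry\<close>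

lemma Lbar_pos:
  assumes "1 < r" "r \<le> 2" "0 < L" "0 < c0" "0 < p"
  shows "0 < Lbar r L c0 p"
  using assms by (auto simp: Lbar_def)

text \<open>This is the square root in the minimum. At \<open>r = 2\<close> the factor
  \<open>r - 1\<close> equals 1, so one bound fits both branches.\<close>

lemma Lbar_square_le:
  assumes "1 < r" "r \<le> 2" "0 < L" "0 < c0" "0 < p"
  shows "p * (Lbar r L c0 p)\<^sup>2 \<le> c0 * (r - 1) / 12"
proof -
  have "Lbar r L c0 p \<le> sqrt (c0 * (r - 1) / (12 * p))"
    using assms by (auto simp: Lbar_def)
  then have "(Lbar r L c0 p)\<^sup>2 \<le> (sqrt (c0 * (r - 1) / (12 * p)))\<^sup>2"
    using Lbar_pos[OF assms] by (intro power_mono) auto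
  also have "\<dots> = c0 * (r - 1) / (12 * p)" using assms by simp
  finally show ?thesis using assms by (simp add: field_simps)
qed

text \<open>The two cases of the construction are merged here. \<open>K4\<close> says that a window
  of length \<open>4 / K\<close> fits into a cell, and \<open>K2\<close> yields the condition
  \<open>ll\<close> of \<open>stair_holder_lt1\<close>.\<close>

lemma gbar_staircase:
  fixes r L c0 p :: real and n :: nat
  defines "K \<equiv> Kn r n" and "B \<equiv> Lbar r L c0 p"
  assumes r: "1 < r" "r \<le> 2" and L: "0 < L" and c0: "0 < c0" and p: "0 < p"
    and K: "1 \<le> K"
    and K4: "r < 2 \<Longrightarrow> 4 \<le> K powr (2 - r)"
    and K2: "r < 2 \<Longrightarrow> 2 \<le> K powr ((r - 1) * (2 - r))"
  obtains S l N where "staircase S (1 / K) l N" "S * (1 / K)\<^sup>2 = B * K powr (- r)" "Mn r n < N"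
    "real (Nn r n) * l \<le> 1"
    "\<And>j x. x \<in> {0..1} \<Longrightarrow> gbar r L c0 p j n x = stair S (1 / K) l N j x"
    "\<And>j x y. 0 \<le> x \<Longrightarrow> x \<le> y \<Longrightarrow> y \<le> 1 \<Longrightarrow>
      stair S (1 / K) l N j y - stair S (1 / K) l N j x \<le> L * (y - x) powr (r - 1)"
proof -
  \<comment> \<open>For \<open>r < 2\<close>, rounding down may leave the right end of the unit
    interval uncovered; one more cell repairs this.\<close>
  define N where "N = Suc (Mn r n)"
  have B: "0 < B" unfolding B_def by (rule Lbar_pos) fact+
  have K0: "0 < K" using K by simp
  have Mlt: "K powr (r - 1) < real N"
    unfolding N_def Mn_def K_def[symmetric] by (simp) linarith
  show ?thesis
  proof (cases "r < 2")
    case True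
    define g S l where "g = r - 1" and "S = B * K powr (1 - g)" and "l = 1 / K powr g"
    have g: "0 < g" "g < 1" using r True by (auto simp: g_def)
    have st: "staircase S (1 / K) l N"
    proof
      show "0 < S" "0 < 1 / K" using B K0 by (auto simp: S_def)
      have "K powr (2 - r) = K / K powr g" using powr_diff[of K 1 g] K0 by (simp add: g_def)
      then have "4 \<le> K / K powr g" using K4[OF True] by simp
      then show "4 * (1 / K) \<le> l" using K0 by (simp add: l_def field_simps)
      show "1 < real N * l" using Mlt K0 by (simp add: l_def g_def field_simps)
    qed
    show ?thesis
    proof (rule that[OF st])
      have "B * (K powr (1 - g) / K powr 2) = B * K powr (- r)"
        by (simp add: g_def flip: powr_diff)
      then show "S * (1 / K)\<^sup>2 = B * K powr (- r)" using K0 by (simp add: S_def power_divide)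
      show "Mn r n < N" by (simp add: N_def)
      have "real (Nn r n) \<le> K powr g"
        using True by (simp add: Nn_def Mn_def g_def flip: K_def)
      then show "real (Nn r n) * l \<le> 1" using K0 by (simp add: l_def field_simps)
    next
      fix j and x :: real assume "x \<in> {0..1}"
      then show "gbar r L c0 p j n x = stair S (1 / K) l N j x"
        unfolding gbar_def using True pert_lt1_eq_stair[OF st K0 S_def refl l_def]
        by (simp add: g_def flip: K_def B_def)
    next
      fix j and x y :: real assume xy: "0 \<le> x" "x \<le> y" "y \<le> 1"
      show "stair S (1 / K) l N j y - stair S (1 / K) l N j x \<le> L * (y - x) powr (r - 1)"
        unfolding g_def[symmetric]
      proof (rule staircase.stair_holder_lt1[OF st g _ _ _ _ xy])
        show "l = (1 / K) powr g" by (simp add: l_def powr_divide)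
        show "S = B * (1 / K) powr (g - 1)"
          using K0 by (simp add: S_def powr_divide powr_diff field_simps)
        \<comment> \<open>Since \<open>l = K powr (- g)\<close>, the identity
          \<open>g * (1 - g) - g = - (g * g)\<close> turns the product into
          \<open>l powr g\<close>.\<close>
        have "2 * l \<le> K powr (g * (1 - g)) * l"
          using K2[OF True] K0 by (intro mult_right_mono) (auto simp: g_def l_def)
        also have "\<dots> = K powr (g * (1 - g) - g)" by (simp add: l_def powr_diff)
        also have "\<dots> = l powr g"
          by (simp add: l_def powr_divide powr_powr algebra_simps flip: powr_minus_divide)
        finally show "2 * l \<le> l powr g" .
        show "4 * B \<le> L" using True by (simp add: B_def Lbar_def)
      qed
    qed
  next
    case False
    with r have r2: "r = 2" by simp
    define l where "l = 4 / K"
    have st: "staircase B (1 / K) l N"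
    proof
      show "0 < B" "0 < 1 / K" "4 * (1 / K) \<le> l" using B K0 by (auto simp: l_def)
      show "1 < real N * l" using Mlt K0 by (simp add: l_def r2 field_simps)
    qed
    show ?thesis
    proof (rule that[OF st])
      show "B * (1 / K)\<^sup>2 = B * K powr (- r)" using K0 by (simp add: r2 powr_minus field_simps power2_eq_square)
      show "Mn r n < N" by (simp add: N_def)
      have "real (Nn r n) \<le> K / 4"
        using K0 of_int_floor_le[of "K / 4"] unfolding Nn_def r2 K_def[symmetric, unfolded r2] by simp
      then show "real (Nn r n) * l \<le> 1" using K0 by (simp add: l_def field_simps)
    next
      fix j and x :: real assume "x \<in> {0..1}"
      then show "gbar r L c0 p j n x = stair B (1 / K) l N j x"
        unfolding gbar_def using False pert_eq1_eq_stair[OF st K0 refl l_def]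
        by (simp flip: K_def B_def)
    next
      fix j and x y :: real assume xy: "0 \<le> x" "x \<le> y" "y \<le> 1"
      have "stair B (1 / K) l N j y - stair B (1 / K) l N j x \<le> B * (y - x)"
        by (rule staircase.stair_lipschitz[OF st xy])
      also have "\<dots> \<le> L * (y - x)" using xy by (intro mult_right_mono) (auto simp: B_def Lbar_def r2)
      finally show "stair B (1 / K) l N j y - stair B (1 / K) l N j x \<le> L * (y - x) powr (r - 1)"
        using xy by (simp add: r2)
    qed
  qed
qed

section \<open>Asymptotics of \<open>Kn\<close> and of the number of functions\<close>

lemma Kn_at_top:
  assumes "1 < r" "0 < c"
  shows "filterlim (\<lambda>n. Kn r n powr c) at_top sequentially"
proof -
  define a where "a = 1 / (2 * r + 1) * c"
  have a: "0 < a" using assms by (simp add: a_def)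
  have "filterlim (\<lambda>n. (real n / ln (real n)) powr a) at_top sequentially"
    using a by real_asymp
  then show ?thesis unfolding Kn_def powr_powr a_def .
qed

lemma nat_floor_ge_half: "1 \<le> z \<Longrightarrow> z / 2 \<le> real (nat \<lfloor>z\<rfloor>)" for z :: real
proof -
  assume z: "1 \<le> z"
  then have "1 \<le> \<lfloor>z\<rfloor>" by simp
  then have "real (nat \<lfloor>z\<rfloor>) = of_int \<lfloor>z\<rfloor>" "1 \<le> real_of_int \<lfloor>z\<rfloor>" by auto
  moreover have "z < of_int \<lfloor>z\<rfloor> + 1" by linarith
  ultimately show ?thesis by linarith
qed

text \<open>The 8 covers a factor 2 from rounding down and the factor 4 in \<open>Nn\<close>; the 5
  bounds \<open>2 * r + 1\<close>.\<close>

lemma ln_cell_count_ge: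
  assumes r: "1 < r" "r \<le> 2" and K: "4 \<le> Kn r n" and n: "1 < ln (real n)"
    and m: "m = Mn r n \<or> m = Nn r n"
  shows "(r - 1) * (ln (real n) - ln (ln (real n))) / 5 - ln 8 \<le> ln (real m)"
proof -
  let ?K = "Kn r n"
  have K0: "0 < ?K" using K by simp
  have n0: "0 < real n" using n by (cases "n = 0") auto
  have K1: "1 \<le> ?K powr (r - 1)" using K r by (intro ge_one_powr_ge_zero) auto
  have M: "?K powr (r - 1) / 8 \<le> real (Mn r n)"
    using nat_floor_ge_half[OF K1] K1 unfolding Mn_def by linarith
  have "?K powr (r - 1) / 8 \<le> real m"
  proof (cases "r < 2")
    case True
    then show ?thesis using M m by (auto simp: Nn_def)
  next
    case False
    then have "?K / 8 \<le> real (Nn r n)"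
      using nat_floor_ge_half[of "?K / 4"] K by (simp add: Nn_def)
    then show ?thesis using M m False r K0 by auto
  qed
  moreover have pos: "0 < ?K powr (r - 1) / 8" using K0 by simp
  ultimately have "ln (?K powr (r - 1) / 8) \<le> ln (real m)"
    by (intro ln_mono) auto
  then have "(r - 1) * ln ?K - ln 8 \<le> ln (real m)"
    using K0 by (simp add: ln_div ln_powr)
  moreover have "ln ?K = (ln (real n) - ln (ln (real n))) / (2 * r + 1)"
    using n n0 by (simp add: Kn_def ln_powr ln_div)
  \<comment> \<open>Enlarging the denominator is allowed because the numerator is nonnegative, by
    \<open>ln t \<le> t - 1\<close>.\<close>
  moreover have "(ln (real n) - ln (ln (real n))) / 5 \<le> (ln (real n) - ln (ln (real n))) / (2 * r + 1)"
    using r n ln_le_minus_one[of "ln (real n)"] by (intro divide_left_mono) auto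
  ultimately show ?thesis
    using r mult_left_mono[of "(ln (real n) - ln (ln (real n))) / 5" "ln ?K" "r - 1"]
    unfolding times_divide_eq_right by linarith
qed

text \<open>The margin is \<open>145/768 < 1/5 \<le> 1/(2 r + 1)\<close>.\<close>
lemma eventually_kullback_budget:
  assumes "0 < g"
  shows "\<forall>\<^sub>F n in sequentially. g / 12 * (145 / 64 * ln (real n) + 1)
    \<le> g * (ln (real n) - ln (ln (real n))) / 5 - ln 8"
proof -
  have "filterlim (\<lambda>n. (ln (real n) - ln (ln (real n))) / 5 - 1 / 12 * (145 / 64 * ln (real n) + 1))
      at_top sequentially"
    by real_asymp
  then have "\<forall>\<^sub>F n in sequentially. ln 8 / g
      \<le> (ln (real n) - ln (ln (real n))) / 5 - 1 / 12 * (145 / 64 * ln (real n) + 1)"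
    by (simp add: filterlim_at_top)
  then show ?thesis
    by eventually_elim (use assms in \<open>simp add: field_simps\<close>)
qed

text \<open>The rate is an exact power of \<open>Kn\<close>, so the ratio in
  \<open>same_order\<close> becomes constant.\<close>

lemma Kn_powr_neg: "Kn r n powr (- r) = (ln (real n) / real n) powr (r / (2 * r + 1))"
proof -
  have "Kn r n powr (- r) = (real n / ln (real n)) powr (- (r / (2 * r + 1)))"
    unfolding Kn_def powr_powr by simp
  also have "\<dots> = (ln (real n) / real n) powr (r / (2 * r + 1))"
    by (cases "n = 0") (simp_all add: powr_minus powr_divide)
  finally show ?thesis .
qed

text \<open>The balance behind the choice of \<open>Kn\<close>: the squared height, of order
  \<open>Kn powr (- 2 * r)\<close>, times the order \<open>n / Kn\<close> of the number of design
  points in a window gives \<open>ln n\<close>.\<close>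

lemma Kn_powr_scale:
  assumes "1 < r" "0 < ln (real n)"
  shows "real n * Kn r n powr (- (2 * r + 1)) = ln (real n)"
proof -
  have n: "0 < real n" using assms(2) by (cases "n = 0") auto
  have "Kn r n powr (- (2 * r + 1)) = (real n / ln (real n)) powr (- 1)"
  proof -
    have "1 / a * - a = - 1" if "a \<noteq> 0" for a :: real using that by simp
    from this[of "2 * r + 1"] show ?thesis unfolding Kn_def powr_powr using assms(1) by simp
  qed
  also have "\<dots> = ln (real n) / real n" using n assms by (simp add: powr_minus)
  finally show ?thesis using n by simp
qed

section \<open>Averaging the divergences and assembling the claims\<close>

lemma ereal_average_le:
  fixes a :: "nat \<Rightarrow> ereal"
  assumes "\<And>j. j \<in> {1..m} \<Longrightarrow> a j \<le> ereal T" "0 < m" "T \<le> U"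
  shows "(\<Sum>j=1..m. a j) / ereal (real m) \<le> ereal U"
proof -
  have "(\<Sum>j=1..m. a j) \<le> (\<Sum>j=1..m. ereal T)" by (intro sum_mono assms)
  also have "\<dots> = ereal (real m * T)" by (simp only: sum_ereal sum_constant) simp
  finally have "(\<Sum>j=1..m. a j) / ereal (real m) \<le> ereal (real m * T) / ereal (real m)"
    using assms(2) by (intro ereal_divide_right_mono) auto
  also have "\<dots> = ereal T" using assms(2) by simp
  finally show ?thesis using assms(3) by (meson ereal_less_eq(3) order_trans)
qed

theorem theorem3p1:
  fixes r L c0 p :: real
    and \<Omega> :: "'a measure" and \<xi> :: "nat \<Rightarrow> 'a \<Rightarrow> real"
  defines "f \<equiv> fjn r L c0 p"
  defines "P \<equiv> (\<lambda>j n. obs_law \<Omega> \<xi> n (f j n))"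
  assumes r: "1 < r" "r \<le> 2"
    and L: "0 < L"
    and c0: "0 < c0" "c0 < 1 / 8"
    and p: "0 < p"
    and prob: "prob_space \<Omega>"
    and indep: "prob_space.indep_vars \<Omega> (\<lambda>_. borel) \<xi> {1..}"
    and ident: "\<forall>i\<ge>1. distr \<Omega> borel (\<xi> i) = distr \<Omega> borel (\<xi> 1)"
    and noise: "\<forall>\<^sub>F n in sequentially. \<forall>j\<in>{0..Mn r n}.
      kullback (P j n) (P 0 n)
        \<le> ereal (p * (\<Sum>i=1..n. (f j n (real i / real n) - f 0 n (real i / real n))\<^sup>2))"
  shows "\<exists>s. same_order s (\<lambda>n. (ln (real n) / real n) powr (r / (2 * r + 1))) \<and>
    (\<forall>\<^sub>F n in sequentially.
      (\<forall>j\<in>{0..Mn r n}. f j n \<in> holder_convex r L) \<and>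
      (\<forall>j\<in>{0..Nn r n}. \<forall>k\<in>{0..Nn r n}. j \<noteq> k \<longrightarrow>
         sup_norm (\<lambda>x. f j n x - f k n x) = 2 * s n) \<and>
      (\<Sum>j=1..Mn r n. kullback (P j n) (P 0 n)) / ereal (real (Mn r n))
        \<le> ereal (c0 * ln (real (Mn r n))) \<and>
      (\<Sum>j=1..Nn r n. kullback (P j n) (P 0 n)) / ereal (real (Nn r n))
        \<le> ereal (c0 * ln (real (Nn r n))))"
proof -
  define B where "B = Lbar r L c0 p"
  \<comment> \<open>Half the common bump height, since the separation is written as
    \<open>2 * s n\<close>.\<close>
  define s where "s n = B / 2 * Kn r n powr (- r)" for n
  have B: "0 < B" unfolding B_def by (rule Lbar_pos) fact+
  have ln1: "\<forall>\<^sub>F n in sequentially. 1 < ln (real n)" by real_asymp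
  have "same_order s (\<lambda>n. (ln (real n) / real n) powr (r / (2 * r + 1)))"
    unfolding same_order_def
  proof (intro exI conjI)
    show "0 < B / 2" "0 < B / 2" using B by auto
    show "\<forall>\<^sub>F n in sequentially.
        B / 2 \<le> s n / (ln (real n) / real n) powr (r / (2 * r + 1)) \<and>
        s n / (ln (real n) / real n) powr (r / (2 * r + 1)) \<le> B / 2"
      using ln1
    proof eventually_elim
      case (elim n)
      have "n \<noteq> 0" "n \<noteq> 1" using elim by (cases "n = 0"; cases "n = 1"; simp)+
      then show ?case using elim by (simp add: s_def Kn_powr_neg)
    qed
  qed
  moreover have "\<forall>\<^sub>F n in sequentially. 4 \<le> Kn r n powr 1"
    using Kn_at_top[OF r(1), of 1] by (auto simp: filterlim_at_top)
  \<comment> \<open>At \<open>r = 2\<close> this exponent and the next one vanish and the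
    inequalities would fail, hence the guard \<open>r < 2\<close>.\<close>
  moreover have "\<forall>\<^sub>F n in sequentially. r < 2 \<longrightarrow> 4 \<le> Kn r n powr (2 - r)"
    using Kn_at_top[OF r(1), of "2 - r"] by (cases "r < 2") (auto simp: filterlim_at_top)
  moreover have "\<forall>\<^sub>F n in sequentially. r < 2 \<longrightarrow> 2 \<le> Kn r n powr ((r - 1) * (2 - r))"
    using Kn_at_top[OF r(1), of "(r - 1) * (2 - r)"] r by (cases "r < 2") (auto simp: filterlim_at_top)
  moreover note ln1 noise eventually_kullback_budget[of "r - 1"]
  ultimately have "same_order s (\<lambda>n. (ln (real n) / real n) powr (r / (2 * r + 1)))" and
    ev: "\<forall>\<^sub>F n in sequentially. 4 \<le> Kn r n powr 1 \<and> (r < 2 \<longrightarrow> 4 \<le> Kn r n powr (2 - r)) \<and>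
      (r < 2 \<longrightarrow> 2 \<le> Kn r n powr ((r - 1) * (2 - r))) \<and> 1 < ln (real n) \<and>
      (\<forall>j\<in>{0..Mn r n}. kullback (P j n) (P 0 n)
        \<le> ereal (p * (\<Sum>i=1..n. (f j n (real i / real n) - f 0 n (real i / real n))\<^sup>2))) \<and>
      (r - 1) / 12 * (145 / 64 * ln (real n) + 1)
        \<le> (r - 1) * (ln (real n) - ln (ln (real n))) / 5 - ln 8"
    using r by (simp_all only: eventually_conj_iff diff_gt_0_iff_gt)
  have main: "(\<forall>j\<in>{0..Mn r n}. f j n \<in> holder_convex r L) \<and>
      (\<forall>j\<in>{0..Nn r n}. \<forall>k\<in>{0..Nn r n}. j \<noteq> k \<longrightarrow>
         sup_norm (\<lambda>x. f j n x - f k n x) = 2 * s n) \<and>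
      (\<Sum>j=1..Mn r n. kullback (P j n) (P 0 n)) / ereal (real (Mn r n))
        \<le> ereal (c0 * ln (real (Mn r n))) \<and>
      (\<Sum>j=1..Nn r n. kullback (P j n) (P 0 n)) / ereal (real (Nn r n))
        \<le> ereal (c0 * ln (real (Nn r n)))"
    if K4: "4 \<le> Kn r n powr 1" and K4': "r < 2 \<longrightarrow> 4 \<le> Kn r n powr (2 - r)"
      and K2: "r < 2 \<longrightarrow> 2 \<le> Kn r n powr ((r - 1) * (2 - r))" and ln1: "1 < ln (real n)"
      and KL: "\<forall>j\<in>{0..Mn r n}. kullback (P j n) (P 0 n)
        \<le> ereal (p * (\<Sum>i=1..n. (f j n (real i / real n) - f 0 n (real i / real n))\<^sup>2))"
      and budget: "(r - 1) / 12 * (145 / 64 * ln (real n) + 1)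
        \<le> (r - 1) * (ln (real n) - ln (ln (real n))) / 5 - ln 8"
    for n
  proof -
    define K where "K = Kn r n"
    have "Kn r n powr 1 = K" by (simp add: K_def Kn_def)
    then have K: "4 \<le> K" "0 < K" "1 \<le> K" using K4 by auto
    have n0: "0 < n" using ln1 by (cases "n = 0") auto
    obtain S l N where st: "staircase S (1 / K) l N" and amp: "S * (1 / K)\<^sup>2 = B * K powr (- r)"
      and MN: "Mn r n < N" and Nl: "real (Nn r n) * l \<le> 1"
      and g: "\<And>j x. x \<in> {0..1} \<Longrightarrow> gbar r L c0 p j n x = stair S (1 / K) l N j x"
      and H: "\<And>j x y. 0 \<le> x \<Longrightarrow> x \<le> y \<Longrightarrow> y \<le> 1 \<Longrightarrow>
        stair S (1 / K) l N j y - stair S (1 / K) l N j x \<le> L * (y - x) powr (r - 1)"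
      using gbar_staircase[OF r L c0(1) p, of n] K K4' K2 unfolding K_def B_def by blast
    interpret staircase S "1 / K" l N by (rule st)
    have NM: "Nn r n \<le> Mn r n"
    proof (cases "r < 2")
      case False
      then have "r = 2" using r by simp
      then show ?thesis using K
        by (simp add: Nn_def Mn_def K_def) (intro nat_mono floor_mono, simp)
    qed (simp add: Nn_def)
    have f: "f j n x = stair_prim S (1 / K) l N j x" if "x \<in> {0..1}" for j x
      unfolding f_def fjn_def using that g by (intro integral_stair) auto
    have fb: "f j n x = f 0 n x - cell_bump j x" if "x \<in> {0..1}" "j \<le> Mn r n" for j x
      using f[OF that(1)] stair_prim_eq[of j x] that MN by simp
    have 1: "f j n \<in> holder_convex r L" for j
      by (rule holder_convex_stair[of _ j]) (use f H in auto)
    have 2: "sup_norm (\<lambda>x. f j n x - f k n x) = 2 * s n" if "j \<le> Nn r n" "k \<le> Nn r n" "j \<noteq> k" for j k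
    proof -
      have cell: "real i * l \<le> 1" if "i \<le> Nn r n" for i
        by (rule order_trans[OF mult_right_mono Nl]) (use that l in auto)
      have "sup_norm (\<lambda>x. f j n x - f k n x) = S * (1 / K)\<^sup>2"
        by (rule sup_norm_cell_bumps[of j k]) (use that cell NM in \<open>auto simp: fb[of _ j] fb[of _ k]\<close>)
      then show ?thesis unfolding amp by (simp add: s_def K_def)
    qed
    \<comment> \<open>A bound for each divergence that is uniform in \<open>j\<close>, and so passes
      to the mean over any range up to \<open>Mn\<close>.\<close>
    define T where "T = c0 * ((r - 1) / 12 * (145 / 64 * ln (real n) + 1))"
    have T0: "0 < T" using c0 r ln1 by (simp add: T_def add_pos_pos)
    have KLT: "kullback (P j n) (P 0 n) \<le> ereal T" if j: "j \<le> Mn r n" for j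
    proof -
      have "(\<Sum>i=1..n. (f j n (real i / real n) - f 0 n (real i / real n))\<^sup>2)
          = (\<Sum>i=1..n. (cell_bump j (real i / real n))\<^sup>2)"
        using j by (intro sum.cong) (auto simp: fb[of _ j])
      also have "\<dots> \<le> (B * K powr (- r))\<^sup>2 * (145 / 64 * (real n * (1 / K)) + 1)"
        using sum_cell_bump_square_le[OF n0, of j] unfolding amp .
      \<comment> \<open>The factor \<open>1 / K\<close> completes the exponent of
        \<open>Kn_powr_scale\<close>; the remaining \<open>K powr (- (2 * r))\<close> is at most
        1.\<close>
      also have "\<dots> = B\<^sup>2 * (145 / 64 * (real n * K powr (- (2 * r + 1))) + K powr (- (2 * r)))"
      proof -
        have sq: "(K powr (- r))\<^sup>2 = K powr (- (2 * r))"
          by (simp add: power2_eq_square flip: powr_add)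
        have "K powr (- (2 * r + 1)) = K powr (- (2 * r)) * (1 / K)"
          using K powr_diff[of K "- (2 * r)" 1] by simp
        then show ?thesis unfolding power_mult_distrib sq by (simp add: distrib_left)
      qed
      also have "\<dots> \<le> B\<^sup>2 * (145 / 64 * ln (real n) + 1)"
      proof -
        have "K powr (- (2 * r)) \<le> K powr 0" using K r by (intro powr_mono) auto
        then have "K powr (- (2 * r)) \<le> 1" using K by simp
        then show ?thesis using Kn_powr_scale[OF r(1), of n] ln1
          by (intro mult_left_mono add_mono) (auto simp: K_def)
      qed
      finally have "p * (\<Sum>i=1..n. (f j n (real i / real n) - f 0 n (real i / real n))\<^sup>2)
          \<le> p * B\<^sup>2 * (145 / 64 * ln (real n) + 1)"
        using p by (simp add: mult_left_mono mult.assoc)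
      also have "\<dots> \<le> c0 * (r - 1) / 12 * (145 / 64 * ln (real n) + 1)"
        unfolding B_def using ln1 Lbar_square_le[OF r L c0(1) p] by (intro mult_right_mono) auto
      also have "\<dots> = T" by (simp add: T_def)
      finally show ?thesis
        using KL j by (meson atLeastAtMost_iff ereal_less_eq(3) le0 order_trans)
    qed
    \<comment> \<open>Both averages at once: \<open>NM\<close> makes \<open>T\<close> valid on
      either range, and \<open>ln_cell_count_ge\<close> bounds both logarithms.\<close>
    have avg: "(\<Sum>j=1..m. kullback (P j n) (P 0 n)) / ereal (real m) \<le> ereal (c0 * ln (real m))"
      if m: "m = Mn r n \<or> m = Nn r n" for m
    proof (rule ereal_average_le)
      show "kullback (P j n) (P 0 n) \<le> ereal T" if "j \<in> {1..m}" for j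
        using that m NM by (intro KLT) auto
      show T: "T \<le> c0 * ln (real m)"
        unfolding T_def using ln_cell_count_ge[OF r, of n m] K(1) ln1 m budget c0
        by (intro mult_left_mono) (auto simp: K_def)
      \<comment> \<open>By convention \<open>ln 0 = 0\<close>, so \<open>m = 0\<close> would give
        \<open>T \<le> 0\<close>.\<close>
      show "0 < m" using T T0 by (cases "m = 0") auto
    qed
    show ?thesis using 1 2 avg by auto
  qed
  show ?thesis
  proof (intro exI conjI)
    show "same_order s (\<lambda>n. (ln (real n) / real n) powr (r / (2 * r + 1)))" by fact
    show "\<forall>\<^sub>F n in sequentially.
      (\<forall>j\<in>{0..Mn r n}. f j n \<in> holder_convex r L) \<and>
      (\<forall>j\<in>{0..Nn r n}. \<forall>k\<in>{0..Nn r n}. j \<noteq> k \<longrightarrow>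
         sup_norm (\<lambda>x. f j n x - f k n x) = 2 * s n) \<and>
      (\<Sum>j=1..Mn r n. kullback (P j n) (P 0 n)) / ereal (real (Mn r n))
        \<le> ereal (c0 * ln (real (Mn r n))) \<and>
      (\<Sum>j=1..Nn r n. kullback (P j n) (P 0 n)) / ereal (real (Nn r n))
        \<le> ereal (c0 * ln (real (Nn r n)))"
      using ev by eventually_elim (rule main; simp)
  qed
qed

end
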